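(* Let $S$ be a finite subset of $\mathbb{H}^2$ that is not contained in a single line. Then there exists a line $\ell$ in $\mathbb{H}^2$ such that $2\leq |S\cap\ell|\leq 24$.
   Context: $\mathbb{H}$ denotes the quaternions. $\mathbb{H}^2$ is regarded as a left vector space over $\mathbb{H}$. A line in $\mathbb{H}^2$ is a set of the form $\{p+\lambda v:\lambda\in\mathbb{H}\}$ with $p,v\in\mathbb{H}^2$, $v\neq 0$, where $\lambda v$ denotes left scalar multiplication. Equivalently, lines are the sets $\{(x,y):x=c\}$ for $c\in\mathbb{H}$ and the sets $\{(x,y): y=xm+c\}$ for $m,c\in\mathbb{H}$. *)

theory Defs
  imports Main "HOL.Real"
begin

text \<open>Quaternions a + b i + c j + d k, with Hamilton's multiplication.\<close>
datatype quat = Quat real real real real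

fun qadd :: "quat \<Rightarrow> quat \<Rightarrow> quat" where
  "qadd (Quat a b c d) (Quat a' b' c' d') = Quat (a + a') (b + b') (c + c') (d + d')"

fun qmul :: "quat \<Rightarrow> quat \<Rightarrow> quat" where
  "qmul (Quat a1 b1 c1 d1) (Quat a2 b2 c2 d2) =
     Quat (a1*a2 - b1*b2 - c1*c2 - d1*d2)
          (a1*b2 + b1*a2 + c1*d2 - d1*c2)
          (a1*c2 - b1*d2 + c1*a2 + d1*b2)
          (a1*d2 + b1*c2 - c1*b2 + d1*a2)"

definition qzero :: quat where "qzero = Quat 0 0 0 0"

type_synonym quat2 = "quat \<times> quat"

definition hline :: "quat2 \<Rightarrow> quat2 \<Rightarrow> quat2 set" where
  "hline p v = {(qadd (fst p) (qmul t (fst v)), qadd (snd p) (qmul t (snd v))) | t. True}"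

definition is_line :: "quat2 set \<Rightarrow> bool" where
  "is_line L \<longleftrightarrow> (\<exists>p v. v \<noteq> (qzero, qzero) \<and> L = hline p v)"

end

theory Submission
  imports Defs Complex_Main "HOL-Library.Product_Plus"
begin

text \<open>
  Suppose every line that meets $S$ in two points meets it in at least 25, and let $n = |S|$.
  For positive weights $t$ on $S$, the affine functions $\alpha + x\beta + y\gamma$ form a
  3-dimensional right Hermitian space under $\sum_p t_p \overline{f(p)} g(p)$, with reproducing kernel $K$.
  Put $\tau_p = t_p K(p,p)$ and $c_{pq} = t_p t_q |K(p,q)|^2$. Then $\sum_p \tau_p = \sum_{p,q} c_{pq} = 3$
  and $c_{pp} = \tau_p^2$. Restricted to a line $\ell$ the kernel has rank at most 2, so
  $\sum_{p,q \in \ell} c_{pq} \ge \frac12 (\sum_{p \in \ell} \tau_p)^2$. Every pair of points lies on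
  exactly one line, so adding this over all lines gives
  $\sum_p r_p \tau_p^2 \ge 3 + \sum_p \tau_p^2$, where $r_p \le (n - 1)/24$ is the number of lines
  through $p$. This is impossible if $\tau_p \le 24/n$ for all $p$.

  Since the average of $\tau$ is only $3/n$, a crude choice of weights is good enough. Let $D(t)$ be the
  sum of $t_a t_b t_c |\det(a,b,c)|^2$ over all triples. Nearly minimising $D$, relative to the product of
  $t_a t_b t_c$ over the noncollinear triples, makes the contribution of each point to $D$ at
  most $\frac{8}{3n} D$, and the triangle inequality in Cramer's rule turns this
  into $\tau_p \le 24/n$.
\<close>

subsection \<open>Quaternions\<close>

instantiation quat :: real_div_algebra
begin

definition zero_quat :: quat where "0 = qzero"
definition one_quat :: quat where "1 = Quat 1 0 0 0"
definition plus_quat :: "quat \<Rightarrow> quat \<Rightarrow> quat" where "x + y = qadd x y"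
definition times_quat :: "quat \<Rightarrow> quat \<Rightarrow> quat" where "x * y = qmul x y"
fun uminus_quat :: "quat \<Rightarrow> quat" where
  "- Quat a b c d = Quat (- a) (- b) (- c) (- d)"
definition minus_quat :: "quat \<Rightarrow> quat \<Rightarrow> quat" where "x - y = x + - y" for x y :: quat
fun scaleR_quat :: "real \<Rightarrow> quat \<Rightarrow> quat" where
  "r *\<^sub>R Quat a b c d = Quat (r * a) (r * b) (r * c) (r * d)"
fun inverse_quat :: "quat \<Rightarrow> quat" where
  "inverse (Quat a b c d) =
     (1 / (a\<^sup>2 + b\<^sup>2 + c\<^sup>2 + d\<^sup>2)) *\<^sub>R Quat a (- b) (- c) (- d)"
definition divide_quat :: "quat \<Rightarrow> quat \<Rightarrow> quat" where "x div y = x * inverse y" for x y :: quat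

lemmas quat_ops = zero_quat_def qzero_def one_quat_def plus_quat_def times_quat_def minus_quat_def
  divide_quat_def

lemma sum_four_squares_eq_0:
  "a\<^sup>2 + b\<^sup>2 + c\<^sup>2 + d\<^sup>2 = 0 \<longleftrightarrow> a = 0 \<and> b = 0 \<and> c = 0 \<and> d = 0" for a b c d :: real
  by (smt (verit) power2_eq_square zero_le_power2 zero_eq_power2)

instance
proof
  fix x y z :: quat and r s :: real
  show "x + y + z = x + (y + z)" "x + y = y + x" "0 + x = x" "- x + x = 0" "x - y = x + - y"
    "x * y * z = x * (y * z)" "1 * x = x" "x * 1 = x"
    "(x + y) * z = x * z + y * z" "x * (y + z) = x * y + x * z"
    "r *\<^sub>R (x + y) = r *\<^sub>R x + r *\<^sub>R y" "(r + s) *\<^sub>R x = r *\<^sub>R x + s *\<^sub>R x"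
    "r *\<^sub>R s *\<^sub>R x = (r * s) *\<^sub>R x" "1 *\<^sub>R x = x"
    "r *\<^sub>R x * y = r *\<^sub>R (x * y)" "x * r *\<^sub>R y = r *\<^sub>R (x * y)"
    by (cases x; cases y; cases z; simp add: quat_ops algebra_simps)+
  show "(0::quat) \<noteq> 1" by (simp add: quat_ops)
  show "inverse x * x = 1" "x * inverse x = 1" if "x \<noteq> 0"
  proof -
    obtain a b c d where x: "x = Quat a b c d" by (cases x)
    have ne: "a\<^sup>2 + b\<^sup>2 + c\<^sup>2 + d\<^sup>2 \<noteq> 0"
      using that by (simp add: x quat_ops sum_four_squares_eq_0)
    have *: "a * a / (a\<^sup>2 + b\<^sup>2 + c\<^sup>2 + d\<^sup>2) + b * b / (a\<^sup>2 + b\<^sup>2 + c\<^sup>2 + d\<^sup>2)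
      + c * c / (a\<^sup>2 + b\<^sup>2 + c\<^sup>2 + d\<^sup>2) + d * d / (a\<^sup>2 + b\<^sup>2 + c\<^sup>2 + d\<^sup>2) = 1"
      using ne by (simp add: add_divide_distrib [symmetric] power2_eq_square)
    show "inverse x * x = 1" "x * inverse x = 1"
      using * by (simp_all add: x quat_ops)
  qed
  show "x div y = x * inverse y" by (simp add: divide_quat_def)
  \<comment> \<open>Division by zero yields 0 in the reals, so the formula for the inverse already
    gives the value that the class demands.\<close>
  show "inverse (0::quat) = 0" by (simp add: quat_ops)
qed

end

section \<open>Conjugation, real part and norm\<close>

fun qcnj :: "quat \<Rightarrow> quat" where "qcnj (Quat a b c d) = Quat a (- b) (- c) (- d)"
fun qre :: "quat \<Rightarrow> real" where "qre (Quat a b c d) = a"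
fun qnorm2 :: "quat \<Rightarrow> real" where "qnorm2 (Quat a b c d) = a\<^sup>2 + b\<^sup>2 + c\<^sup>2 + d\<^sup>2"

lemma qcnj_simps [simp]:
  "qcnj (x + y) = qcnj x + qcnj y" "qcnj (x - y) = qcnj x - qcnj y" "qcnj (- x) = - qcnj x"
  "qcnj (x * y) = qcnj y * qcnj x" "qcnj (r *\<^sub>R x) = r *\<^sub>R qcnj x"
  "qcnj (qcnj x) = x" "qcnj 0 = 0" "qcnj 1 = 1"
  by (cases x; cases y; simp add: quat_ops algebra_simps)+

lemma qcnj_sum: "qcnj (sum f A) = (\<Sum>i\<in>A. qcnj (f i))"
  by (induction A rule: infinite_finite_induct) auto

lemma qre_simps [simp]:
  "qre (x + y) = qre x + qre y" "qre (x - y) = qre x - qre y" "qre (- x) = - qre x"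
  "qre (r *\<^sub>R x) = r * qre x" "qre (qcnj x) = qre x" "qre 0 = 0" "qre 1 = 1"
  by (cases x; cases y; simp add: quat_ops)+

lemma qre_of_real [simp]: "qre (of_real r) = r"
  by (simp add: of_real_def)

lemma qre_sum: "qre (sum f A) = (\<Sum>i\<in>A. qre (f i))"
  by (induction A rule: infinite_finite_induct) auto

text \<open>This cyclicity of the trace stands in for commutativity: \<open>trace_line_le\<close>
  uses it to separate the factors at \<open>p\<close> from those at \<open>q\<close>.\<close>

lemma qre_mult_commute: "qre (x * y) = qre (y * x)"
  by (cases x; cases y; simp add: quat_ops)

lemma mult_qcnj: "x * qcnj x = of_real (qnorm2 x)" "qcnj x * x = of_real (qnorm2 x)"
  by (cases x; simp add: quat_ops of_real_def power2_eq_square)+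

lemma qnorm2_nonneg [simp]: "0 \<le> qnorm2 x"
  by (cases x) simp

lemma qnorm2_eq_0_iff [simp]: "qnorm2 x = 0 \<longleftrightarrow> x = 0"
  by (cases x) (simp add: quat_ops sum_four_squares_eq_0)

lemma qnorm2_pos_iff [simp]: "0 < qnorm2 x \<longleftrightarrow> x \<noteq> 0"
  by (metis less_le qnorm2_nonneg qnorm2_eq_0_iff)

lemma qnorm2_simps [simp]: "qnorm2 (qcnj x) = qnorm2 x" "qnorm2 (- x) = qnorm2 x"
  "qnorm2 (r *\<^sub>R x) = r\<^sup>2 * qnorm2 x" "qnorm2 0 = 0" "qnorm2 1 = 1"
  by (cases x; simp add: quat_ops algebra_simps)+

lemma qnorm2_mult: "qnorm2 (x * y) = qnorm2 x * qnorm2 y"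
  by (cases x; cases y; simp add: quat_ops power2_eq_square algebra_simps)

lemma qnorm2_add: "qnorm2 (x + y) = qnorm2 x + qnorm2 y + 2 * qre (x * qcnj y)"
  by (cases x; cases y; simp add: quat_ops power2_eq_square algebra_simps)

text \<open>The deficit is the sum of the squared pairwise differences. The factor 3 enters the
  final constant as 24 = 3 * 3 * 8/3.\<close>

lemma qnorm2_add3_le: "qnorm2 (x + y + z) \<le> 3 * (qnorm2 x + qnorm2 y + qnorm2 z)"
proof -
  have "3 * (qnorm2 x + qnorm2 y + qnorm2 z) - qnorm2 (x + y + z)
      = qnorm2 (x - y) + qnorm2 (y - z) + qnorm2 (x - z)"
    by (cases x; cases y; cases z; simp add: quat_ops power2_eq_square algebra_simps)
  then show ?thesis
    by (smt (verit) qnorm2_nonneg)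
qed

subsection \<open>Lines and affine functions\<close>

definition lscale :: "quat \<Rightarrow> quat2 \<Rightarrow> quat2" where
  "lscale t v = (t * fst v, t * snd v)"

definition line_thru :: "quat2 \<Rightarrow> quat2 \<Rightarrow> quat2 set" where
  "line_thru a b = hline a (b - a)"

lemma lscale_simps [simp]:
  "lscale s (lscale t v) = lscale (s * t) v" "lscale 1 v = v" "lscale 0 v = 0"
  "lscale t 0 = 0" "lscale (- t) v = - lscale t v"
  by (auto simp: lscale_def prod_eq_iff algebra_simps)

lemma lscale_add: "lscale (s + t) v = lscale s v + lscale t v"
  and lscale_diff: "lscale (s - t) v = lscale s v - lscale t v"
  by (auto simp: lscale_def prod_eq_iff algebra_simps)

lemma mem_hline_iff: "x \<in> hline p v \<longleftrightarrow> (\<exists>t. x = p + lscale t v)"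
  by (auto simp: hline_def lscale_def prod_eq_iff plus_quat_def times_quat_def)

lemma is_line_iff: "is_line L \<longleftrightarrow> (\<exists>p v. v \<noteq> 0 \<and> L = hline p v)"
  by (simp add: is_line_def zero_prod_def zero_quat_def)

lemma is_line_line_thru: "a \<noteq> b \<Longrightarrow> is_line (line_thru a b)"
  unfolding is_line_iff line_thru_def by (metis right_minus_eq)

lemma mem_line_thru [simp]: "a \<in> line_thru a b" "b \<in> line_thru a b"
  unfolding line_thru_def mem_hline_iff
  by (metis add.right_neutral lscale_simps(3)) (metis add.commute diff_add_cancel lscale_simps(2))

text \<open>The two points have parameters with invertible difference \<open>t - s\<close>, so
  multiplication by its inverse reparametrises the line from \<open>a\<close> towards
  \<open>b\<close>.\<close>

lemma is_line_eq_line_thru: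
  assumes "is_line L" "a \<in> L" "b \<in> L" "a \<noteq> b"
  shows "L = line_thru a b"
proof -
  obtain p v where v: "v \<noteq> 0" and L: "L = hline p v"
    using assms by (auto simp: is_line_iff)
  obtain s t where a: "a = p + lscale s v" and b: "b = p + lscale t v"
    using assms by (auto simp: L mem_hline_iff)
  have ba: "b - a = lscale (t - s) v" by (simp add: a b lscale_diff)
  have ts: "t - s \<noteq> 0" using assms a b by auto
  have "x \<in> L \<longleftrightarrow> x \<in> line_thru a b" for x
  proof
    assume "x \<in> L"
    then obtain w where "x = p + lscale w v" by (auto simp: L mem_hline_iff)
    also have "\<dots> = a + lscale ((w - s) * inverse (t - s)) (b - a)"
      using ts by (simp add: ba mult.assoc) (simp add: a lscale_diff)
    finally show "x \<in> line_thru a b" by (auto simp: line_thru_def mem_hline_iff)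
  next
    assume "x \<in> line_thru a b"
    then obtain w where "x = a + lscale w (b - a)" by (auto simp: line_thru_def mem_hline_iff)
    also have "\<dots> = p + lscale (s + w * (t - s)) v"
      by (simp add: ba) (simp add: a lscale_add)
    finally show "x \<in> L" by (auto simp: L mem_hline_iff)
  qed
  then show ?thesis by blast
qed

text \<open>\<open>a \<noteq> b\<close> is demanded separately because \<open>line_thru a a\<close>
  is the single point \<open>a\<close>.\<close>

definition noncollinear :: "quat2 \<Rightarrow> quat2 \<Rightarrow> quat2 \<Rightarrow> bool" where
  "noncollinear a b c \<longleftrightarrow> a \<noteq> b \<and> c \<notin> line_thru a b"

lemma noncollinear_swap:
  assumes "noncollinear a b c"
  shows "noncollinear b a c" "noncollinear a c b"
proof -
  have ab: "a \<noteq> b" "c \<notin> line_thru a b" using assms by (auto simp: noncollinear_def)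
  have "line_thru b a = line_thru a b"
    using ab is_line_eq_line_thru [OF is_line_line_thru, of b a a b] by auto
  then show "noncollinear b a c" using ab by (auto simp: noncollinear_def)
  have "a \<noteq> c" using ab by auto
  moreover have "b \<notin> line_thru a c"
    using is_line_eq_line_thru [OF is_line_line_thru, of a c a b] ab \<open>a \<noteq> c\<close>
    by (metis mem_line_thru)
  ultimately show "noncollinear a c b" by (auto simp: noncollinear_def)
qed

section \<open>Hermitian form and Gram determinants\<close>

definition herm :: "quat2 \<Rightarrow> quat2 \<Rightarrow> quat" where
  "herm u v = fst u * qcnj (fst v) + snd u * qcnj (snd v)"

definition hnorm2 :: "quat2 \<Rightarrow> real" where
  "hnorm2 u = qnorm2 (fst u) + qnorm2 (snd u)"

definition gram :: "quat2 \<Rightarrow> quat2 \<Rightarrow> real" where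
  "gram u v = hnorm2 u * hnorm2 v - qnorm2 (herm u v)"

lemma hnorm2_nonneg [simp]: "0 \<le> hnorm2 u"
  by (simp add: hnorm2_def)

lemma hnorm2_eq_0_iff [simp]: "hnorm2 u = 0 \<longleftrightarrow> u = 0"
  by (simp add: hnorm2_def prod_eq_iff add_nonneg_eq_0_iff)

lemma herm_simps:
  "herm (u + u') v = herm u v + herm u' v" "herm (u - u') v = herm u v - herm u' v"
  "herm (lscale t u) v = t * herm u v" "herm u (lscale t v) = herm u v * qcnj t"
  "herm u u = of_real (hnorm2 u)" "herm 0 v = 0"
  by (auto simp: herm_def hnorm2_def lscale_def algebra_simps mult_qcnj)

lemma qcnj_herm: "qcnj (herm u v) = herm v u"
  by (simp add: herm_def)

lemma hnorm2_lscale: "hnorm2 (lscale t u) = qnorm2 t * hnorm2 u"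
  by (simp add: hnorm2_def lscale_def qnorm2_mult algebra_simps)

lemma hnorm2_add: "hnorm2 (u + v) = hnorm2 u + hnorm2 v + 2 * qre (herm u v)"
  by (simp add: hnorm2_def herm_def qnorm2_add)

lemma gram_commute: "gram u v = gram v u"
  by (metis gram_def mult.commute qcnj_herm qnorm2_simps(1))

lemma gram_lscale: "gram (lscale t u) v = qnorm2 t * gram u v"
  by (simp add: gram_def hnorm2_lscale herm_simps qnorm2_mult algebra_simps)

lemma gram_minus: "gram (- u) v = gram u v" "gram u (- v) = gram u v"
  using gram_lscale [of "-1"] by (simp_all add: gram_commute [of u])

text \<open>This invariance under row operations and the scaling law \<open>gram_lscale\<close> are
  all that Cramer's rule needs in \<open>area2_replace_first\<close>.\<close>

lemma gram_add_lscale: "gram (u + lscale t v) v = gram u v"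
  by (simp add: gram_def hnorm2_add hnorm2_lscale herm_simps qnorm2_add of_real_def
      power2_eq_square algebra_simps)

text \<open>One Gram-Schmidt step: squared area is squared base times squared height. The height
  vector also yields the functions of \<open>affs_separating\<close>.\<close>

lemma gram_orthogonal_component:
  assumes "v \<noteq> 0"
  obtains t where "herm (u + lscale t v) v = 0" "gram u v = hnorm2 (u + lscale t v) * hnorm2 v"
proof -
  define t where "t = - ((1 / hnorm2 v) *\<^sub>R herm u v)"
  have 1: "herm (u + lscale t v) v = 0"
    using assms by (simp add: herm_simps t_def of_real_def)
  have "gram u v = gram (u + lscale t v) v" by (simp add: gram_add_lscale)
  also have "\<dots> = hnorm2 (u + lscale t v) * hnorm2 v" by (simp add: gram_def 1)
  finally show thesis using 1 that by blast
qed

text \<open>The squared absolute value of the determinant with rows $a - c$ and $b - c$, written as a Gram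
  determinant to avoid Dieudonne determinants over the quaternions.\<close>

definition area2 :: "quat2 \<Rightarrow> quat2 \<Rightarrow> quat2 \<Rightarrow> real" where
  "area2 a b c = gram (a - c) (b - c)"

lemma area2_swap12: "area2 a b c = area2 b a c"
  by (simp add: area2_def gram_commute)

text \<open>Moving the base point from \<open>c\<close> to \<open>b\<close> changes the rows by a
  row operation and a sign. Together with \<open>area2_swap12\<close> this gives all
  permutations.\<close>

lemma area2_swap23: "area2 a b c = area2 a c b"
proof -
  have "area2 a c b = gram ((a - c) + lscale (- 1) (b - c)) (- (b - c))"
    by (simp add: area2_def)
  also have "\<dots> = area2 a b c"
    by (simp only: gram_minus gram_add_lscale area2_def)
  finally show ?thesis by simp
qed

lemma area2_nonneg [simp]: "0 \<le> area2 a b c"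
proof (cases "b = c")
  case True
  then show ?thesis by (simp add: area2_def gram_def hnorm2_def herm_def)
next
  case False
  then show ?thesis
    by (metis area2_def gram_orthogonal_component hnorm2_nonneg mult_nonneg_nonneg right_minus_eq)
qed

lemma area2_same [simp]: "area2 a b b = 0" "area2 a a b = 0" "area2 a b a = 0"
proof -
  show *: "area2 a b b = 0" for a b :: quat2
    by (simp add: area2_def gram_def hnorm2_def herm_def)
  show "area2 a b a = 0" using * [of b a] by (simp add: area2_swap12)
  then show "area2 a a b = 0" by (simp add: area2_swap23)
qed

text \<open>Over the base \<open>b - a\<close>, the area vanishes exactly when the height does, that
  is, when \<open>c - a\<close> is a left multiple of \<open>b - a\<close>.\<close>

lemma area2_pos_iff: "0 < area2 a b c \<longleftrightarrow> noncollinear a b c"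
proof (cases "a = b")
  case True
  then show ?thesis by (simp add: noncollinear_def)
next
  case False
  have "area2 a b c = gram (c - a) (b - a)"
    using area2_swap12 area2_swap23 by (metis area2_def)
  moreover obtain t where t: "gram (c - a) (b - a) = hnorm2 ((c - a) + lscale t (b - a)) * hnorm2 (b - a)"
    using gram_orthogonal_component False by (metis right_minus_eq)
  moreover have "hnorm2 (b - a) \<noteq> 0" using False by simp
  ultimately have "area2 a b c = 0 \<Longrightarrow> (c - a) + lscale t (b - a) = 0"
    by simp
  moreover have "c = ((c - a) + lscale t (b - a)) + (a + lscale (- t) (b - a))" by simp
  ultimately have 1: "area2 a b c = 0 \<Longrightarrow> c \<in> line_thru a b"
    unfolding line_thru_def mem_hline_iff by (metis add_0)
  have "area2 a b c = 0" if "c \<in> line_thru a b"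
  proof -
    from that obtain t where "c = a + lscale t (b - a)" by (auto simp: line_thru_def mem_hline_iff)
    then have "gram (c - a) (b - a) = gram (0 + lscale t (b - a)) (b - a)" by simp
    also have "\<dots> = 0" by (simp only: gram_add_lscale) (simp add: gram_def hnorm2_def herm_def)
    finally show ?thesis using \<open>area2 a b c = gram (c - a) (b - a)\<close> by simp
  qed
  with 1 False show ?thesis
    unfolding noncollinear_def by (metis area2_nonneg less_le)
qed

text \<open>The coefficients act from the right, so that the zero sets are lines of the left space.\<close>

definition affs :: "(quat2 \<Rightarrow> quat) set" where
  "affs = {f. \<exists>\<alpha> \<beta> \<gamma>. f = (\<lambda>p. \<alpha> + fst p * \<beta> + snd p * \<gamma>)}"

lemma affsI: "(\<And>p. f p = \<alpha> + fst p * \<beta> + snd p * \<gamma>) \<Longrightarrow> f \<in> affs"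
  unfolding affs_def by blast

lemma affsE:
  assumes "f \<in> affs"
  obtains \<alpha> \<beta> \<gamma> where "\<And>p. f p = \<alpha> + fst p * \<beta> + snd p * \<gamma>"
  using assms unfolding affs_def by auto

lemma affs_const: "(\<lambda>p. c) \<in> affs" and affs_fst: "fst \<in> affs" and affs_snd: "snd \<in> affs"
  by (rule affsI [of _ c 0 0], simp) (rule affsI [of _ 0 1 0], simp, rule affsI [of _ 0 0 1], simp)

lemma affs_add: assumes "f \<in> affs" "g \<in> affs" shows "(\<lambda>p. f p + g p) \<in> affs"
proof -
  obtain \<alpha> \<beta> \<gamma> \<alpha>' \<beta>' \<gamma>' where
    "\<And>p. f p = \<alpha> + fst p * \<beta> + snd p * \<gamma>" "\<And>p. g p = \<alpha>' + fst p * \<beta>' + snd p * \<gamma>'"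
    using assms by (auto elim!: affsE)
  then show ?thesis by (intro affsI [of _ "\<alpha> + \<alpha>'" "\<beta> + \<beta>'" "\<gamma> + \<gamma>'"]) (simp add: algebra_simps)
qed

lemma affs_mult: assumes "f \<in> affs" shows "(\<lambda>p. f p * c) \<in> affs"
proof -
  obtain \<alpha> \<beta> \<gamma> where "\<And>p. f p = \<alpha> + fst p * \<beta> + snd p * \<gamma>"
    using assms by (auto elim!: affsE)
  then show ?thesis by (intro affsI [of _ "\<alpha> * c" "\<beta> * c" "\<gamma> * c"]) (simp add: algebra_simps)
qed

lemma affs_diff: assumes "f \<in> affs" "g \<in> affs" shows "(\<lambda>p. f p - g p) \<in> affs"
  using affs_add [OF assms(1) affs_mult [OF assms(2), of "- 1"]] by simp

lemma affs_scaleR: assumes "f \<in> affs" shows "(\<lambda>p. r *\<^sub>R f p) \<in> affs"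
  using affs_mult [OF assms, of "r *\<^sub>R 1"] by simp

lemmas affs_intros = affs_const affs_fst affs_snd affs_add affs_diff affs_mult affs_scaleR

lemma affs_line:
  assumes "f \<in> affs"
  shows "f (a + lscale t (b - a)) = f a + t * (f b - f a)"
proof -
  obtain \<alpha> \<beta> \<gamma> where "\<And>p. f p = \<alpha> + fst p * \<beta> + snd p * \<gamma>"
    using assms by (auto elim!: affsE)
  then show ?thesis by (simp add: lscale_def algebra_simps)
qed

lemma affs_eq_0_on_line:
  assumes "f \<in> affs" "f a = 0" "f b = 0" "p \<in> line_thru a b"
  shows "f p = 0"
  using assms affs_line [OF assms(1), of a _ b] by (auto simp: line_thru_def mem_hline_iff)

text \<open>Pair \<open>p - a\<close> with the component \<open>w\<close> of \<open>c - a\<close>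
  orthogonal to \<open>b - a\<close>, and divide by \<open>hnorm2 w\<close>. The conjugates of
  \<open>w\<close> stand on the right, so this is an element of \<open>affs\<close>.\<close>

lemma affs_separating:
  assumes "noncollinear a b c"
  obtains e where "e \<in> affs" "e a = 0" "e b = 0" "e c = 1"
proof -
  have ab: "b - a \<noteq> 0" "c \<notin> line_thru a b" using assms by (auto simp: noncollinear_def)
  obtain t where t: "herm ((c - a) + lscale t (b - a)) (b - a) = 0"
    using gram_orthogonal_component ab(1) by metis
  define w where "w = (c - a) + lscale t (b - a)"
  have "w \<noteq> 0"
  proof
    assume "w = 0"
    moreover have "c = w + (a + lscale (- t) (b - a))" by (simp add: w_def)
    ultimately have "c = a + lscale (- t) (b - a)" by (metis add_0)
    then show False using ab unfolding line_thru_def mem_hline_iff by blast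
  qed
  define e where "e = (\<lambda>p. (1 / hnorm2 w) *\<^sub>R herm (p - a) w)"
  have bw: "herm (b - a) w = 0" using t qcnj_herm [of w "b - a"] by (simp add: w_def)
  have "herm (c - a) w = herm (w - lscale t (b - a)) w" by (simp add: w_def)
  also have "\<dots> = of_real (hnorm2 w)" by (subst herm_simps(2), subst herm_simps(3)) (simp add: bw herm_simps(5))
  finally have cw: "herm (c - a) w = of_real (hnorm2 w)" .
  show thesis
  proof
    have "(\<lambda>p. (1 / hnorm2 w) *\<^sub>R ((fst p - fst a) * qcnj (fst w) + (snd p - snd a) * qcnj (snd w))) \<in> affs"
      by (intro affs_intros)
    then show "e \<in> affs" by (simp add: e_def herm_def)
    show "e a = 0" "e b = 0" "e c = 1"
      using \<open>w \<noteq> 0\<close> by (simp_all add: e_def bw cw herm_simps(6) of_real_def)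
  qed
qed

text \<open>The linear part of \<open>f\<close> kills \<open>c - a\<close> and \<open>b - a\<close>.
  Were it nonzero, its zeros would form a one-dimensional left space, and these two vectors would be
  proportional.\<close>

lemma affs_eq_0:
  assumes f: "f \<in> affs" and nc: "noncollinear a b c" and "f a = 0" "f b = 0" "f c = 0"
  shows "f p = 0"
proof -
  obtain \<alpha> \<beta> \<gamma> where fp: "\<And>p. f p = \<alpha> + fst p * \<beta> + snd p * \<gamma>"
    using f by (auto elim!: affsE)
  define u v where "u = c - a" and "v = b - a"
  have v: "v \<noteq> 0" using nc by (auto simp: noncollinear_def v_def)
  have u: "u \<noteq> lscale t v" for t
  proof
    assume "u = lscale t v"
    then have "c = a + lscale t (b - a)" unfolding u_def v_def by (metis add.commute diff_add_cancel)
    then show False using nc unfolding noncollinear_def line_thru_def mem_hline_iff by blast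
  qed
  have lin: "fst u * \<beta> + snd u * \<gamma> = 0" "fst v * \<beta> + snd v * \<gamma> = 0"
  proof -
    have "fst u * \<beta> + snd u * \<gamma> = f c - f a" "fst v * \<beta> + snd v * \<gamma> = f b - f a"
      by (simp_all add: fp u_def v_def algebra_simps)
    then show "fst u * \<beta> + snd u * \<gamma> = 0" "fst v * \<beta> + snd v * \<gamma> = 0"
      using assms(3-5) by simp_all
  qed
  have g0: "\<gamma> = 0"
  proof (rule ccontr)
    assume "\<gamma> \<noteq> 0"
    define m where "m = - \<beta> * inverse \<gamma>"
    have s: "snd x = fst x * m" if "fst x * \<beta> + snd x * \<gamma> = 0" for x :: quat2
    proof -
      have "snd x * \<gamma> = - (fst x * \<beta>)" using that by (simp add: add_eq_0_iff)
      then have "snd x * \<gamma> * inverse \<gamma> = - (fst x * \<beta>) * inverse \<gamma>" by simp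
      then show ?thesis using \<open>\<gamma> \<noteq> 0\<close> by (simp add: m_def mult.assoc)
    qed
    have "fst v \<noteq> 0" using v s [OF lin(2)] by (auto simp: prod_eq_iff)
    then have "fst u * inverse (fst v) * snd v = fst u * m"
      unfolding s [OF lin(2)] by (metis left_inverse mult.assoc mult_1_right)
    then have "u = lscale (fst u * inverse (fst v)) v"
      using s [OF lin(1)] \<open>fst v \<noteq> 0\<close> by (auto simp: lscale_def prod_eq_iff mult.assoc)
    then show False using u by blast
  qed
  have b0: "\<beta> = 0"
  proof (rule ccontr)
    assume "\<beta> \<noteq> 0"
    then have "fst v = 0" "fst u = 0" using lin g0 by auto
    then have "snd v \<noteq> 0" using v by (auto simp: prod_eq_iff)
    then have "u = lscale (snd u * inverse (snd v)) v"
      using \<open>fst v = 0\<close> \<open>fst u = 0\<close> by (simp add: lscale_def prod_eq_iff mult.assoc)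
    then show False using u by blast
  qed
  show ?thesis using assms(3) fp b0 g0 by simp
qed

section \<open>Barycentric coordinates and Cramer's rule\<close>

locale barycentric =
  fixes a b c :: quat2 and ea eb ec :: "quat2 \<Rightarrow> quat"
  assumes affs: "ea \<in> affs" "eb \<in> affs" "ec \<in> affs"
    and val: "ea a = 1" "ea b = 0" "ea c = 0" "eb a = 0" "eb b = 1" "eb c = 0"
      "ec a = 0" "ec b = 0" "ec c = 1"
    and nc: "noncollinear a b c"
begin

lemma expand:
  assumes "f \<in> affs"
  shows "f p = ea p * f a + eb p * f b + ec p * f c"
proof -
  have "(\<lambda>p. f p - (ea p * f a + eb p * f b + ec p * f c)) p = 0"
    by (rule affs_eq_0 [OF _ nc]) (use assms affs val in \<open>auto intro!: affs_intros\<close>)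
  then show ?thesis by simp
qed

text \<open>Cramer's rule in squared absolute values: \<open>p - c\<close> is
  \<open>lscale (ea p) (a - c)\<close> up to a row operation with \<open>b - c\<close>.\<close>

lemma area2_replace_first: "area2 p b c = qnorm2 (ea p) * area2 a b c"
proof -
  have "ea p + eb p + ec p = 1" using expand [OF affs_const [of 1]] by simp
  then have ec: "ec p = 1 - ea p - eb p" by (simp add: algebra_simps)
  have "p - c = lscale (ea p) (a - c) + lscale (eb p) (b - c)"
    using expand [OF affs_fst, of p] expand [OF affs_snd, of p]
    unfolding ec by (simp add: lscale_def prod_eq_iff algebra_simps)
  then show ?thesis
    by (simp only: area2_def gram_add_lscale gram_lscale)
qed

end

lemma barycentric_exists:
  assumes "noncollinear a b c"
  obtains ea eb ec where "barycentric a b c ea eb ec"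
proof -
  note nc = noncollinear_swap [OF assms]
  obtain ec where "ec \<in> affs" "ec a = 0" "ec b = 0" "ec c = 1"
    using affs_separating [OF assms] .
  moreover obtain eb where "eb \<in> affs" "eb a = 0" "eb c = 0" "eb b = 1"
    using affs_separating [OF nc(2)] .
  moreover obtain ea where "ea \<in> affs" "ea b = 0" "ea c = 0" "ea a = 1"
    using affs_separating [OF noncollinear_swap(2) [OF nc(1)]] .
  ultimately have "barycentric a b c ea eb ec" using assms by unfold_locales
  then show thesis by (rule that)
qed

text \<open>Expand \<open>f p\<close> in barycentric coordinates, and turn each squared coordinate
  into an area with one vertex replaced by \<open>p\<close>. For collinear triples the left side is
  0, so the bound can be summed over all triples.\<close>

lemma qnorm2_affs_area2_le:
  assumes f: "f \<in> affs"
  shows "qnorm2 (f p) * area2 a b c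
    \<le> 3 * (qnorm2 (f a) * area2 p b c + qnorm2 (f b) * area2 p a c + qnorm2 (f c) * area2 p a b)"
proof (cases "noncollinear a b c")
  case False
  then have "area2 a b c = 0" using area2_pos_iff area2_nonneg less_le by metis
  then show ?thesis by simp
next
  case True
  obtain ea eb ec where bary: "barycentric a b c ea eb ec" using barycentric_exists [OF True] .
  interpret barycentric a b c ea eb ec by (fact bary)
  \<comment> \<open>Permuting the vertices carries the formula for the first coordinate over to the
    other two.\<close>
  interpret b: barycentric b a c eb ea ec
    using affs val noncollinear_swap [OF True] by unfold_locales
  interpret c: barycentric c a b ec ea eb
    using affs val noncollinear_swap(1) [OF noncollinear_swap(2) [OF True]] by unfold_locales
  have "qnorm2 (f p) * area2 a b c
      \<le> 3 * (qnorm2 (ea p * f a) + qnorm2 (eb p * f b) + qnorm2 (ec p * f c)) * area2 a b c"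
    unfolding expand [OF f, of p] by (intro mult_right_mono qnorm2_add3_le) simp
  also have "\<dots> = 3 * (qnorm2 (f a) * area2 p b c + qnorm2 (f b) * area2 p a c + qnorm2 (f c) * area2 p a b)"
    unfolding area2_replace_first [of p] b.area2_replace_first [of p] c.area2_replace_first [of p]
      area2_swap12 [of b a c] area2_swap12 [of c a b] area2_swap23 [of a c b]
    by (simp add: qnorm2_mult algebra_simps)
  finally show ?thesis .
qed

subsection \<open>Balancing a symmetric tensor\<close>

text \<open>The weights $t$ nearly minimise $G(t) = |N| \ln D(t) - \sum_N \ln (t_a t_b t_c)$. This is bounded below
  because $D(t)$ dominates each of its terms, so halving a single weight $t_p$ can hardly decrease $G$.\<close>

lemma tensor_scaling:
  fixes d :: "'a \<Rightarrow> 'a \<Rightarrow> 'a \<Rightarrow> real" and S :: "'a set"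
  defines "N \<equiv> {(a, b, c). a \<in> S \<and> b \<in> S \<and> c \<in> S \<and> 0 < d a b c}"
  assumes fin: "finite S" and ne: "S \<noteq> {}"
    and nn: "\<And>a b c. 0 \<le> d a b c"
    and sym: "\<And>a b c. d a b c = d b a c" "\<And>a b c. d a b c = d a c b"
    and same: "\<And>a b. d a a b = 0"
    and cardN: "4 * real (card S) ^ 3 \<le> 5 * real (card N)"
  obtains t where "\<And>p. 0 < t p"
    "0 < (\<Sum>a\<in>S. \<Sum>b\<in>S. \<Sum>c\<in>S. t a * t b * t c * d a b c)"
    "\<And>p. p \<in> S \<Longrightarrow> 3 * real (card S) * (\<Sum>b\<in>S. \<Sum>c\<in>S. t p * t b * t c * d p b c)
       \<le> 8 * (\<Sum>a\<in>S. \<Sum>b\<in>S. \<Sum>c\<in>S. t a * t b * t c * d a b c)"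
proof -
  define n where "n = real (card S)"
  define M where "M = real (card N)"
  define D where "D t = (\<Sum>a\<in>S. \<Sum>b\<in>S. \<Sum>c\<in>S. t a * t b * t c * d a b c)" for t :: "'a \<Rightarrow> real"
  define T where "T t p = (\<Sum>b\<in>S. \<Sum>c\<in>S. t p * t b * t c * d p b c)" for t :: "'a \<Rightarrow> real" and p
  define G where "G t = M * ln (D t) - (\<Sum>(a, b, c)\<in>N. ln (t a * t b * t c))" for t :: "'a \<Rightarrow> real"
  have n: "0 < n" using fin ne by (simp add: n_def card_gt_0_iff)
  have finN: "finite N"
    by (rule finite_subset [of _ "S \<times> S \<times> S"]) (auto simp: N_def fin)
  have M: "4 * n ^ 3 \<le> 5 * M" using cardN by (simp add: n_def M_def)
  have Mpos: "0 < M" using M n by (smt (verit) zero_less_power)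
  then have "N \<noteq> {}" by (auto simp: M_def)
  then obtain a0 b0 c0 where N0: "(a0, b0, c0) \<in> N" by auto

  have D_ge: "t a * t b * t c * d a b c \<le> D t" if t: "\<And>p. 0 < t p" and "(a, b, c) \<in> N" for t a b c
  proof -
    have abc: "a \<in> S" "b \<in> S" "c \<in> S" using \<open>(a, b, c) \<in> N\<close> by (simp_all add: N_def)
    have nn': "0 \<le> t a * t b * t c * d a b c" for a b c using t nn by (simp add: less_imp_le)
    have "t a * t b * t c * d a b c \<le> (\<Sum>c\<in>S. t a * t b * t c * d a b c)"
      by (rule member_le_sum [where f = "\<lambda>c. t a * t b * t c * d a b c"]) (use abc nn' fin in auto)
    also have "\<dots> \<le> (\<Sum>b\<in>S. \<Sum>c\<in>S. t a * t b * t c * d a b c)"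
      by (rule member_le_sum [where f = "\<lambda>b. \<Sum>c\<in>S. t a * t b * t c * d a b c"])
        (use abc nn' fin in \<open>auto intro!: sum_nonneg\<close>)
    also have "\<dots> \<le> D t" unfolding D_def
      by (rule member_le_sum [where f = "\<lambda>a. \<Sum>b\<in>S. \<Sum>c\<in>S. t a * t b * t c * d a b c"])
        (use abc nn' fin in \<open>auto intro!: sum_nonneg\<close>)
    finally show ?thesis .
  qed
  have D_pos: "0 < D t" if t: "\<And>p. 0 < t p" for t
  proof -
    have "0 < t a0 * t b0 * t c0 * d a0 b0 c0" using t N0 by (simp add: N_def)
    then show ?thesis using D_ge [of t, OF t N0] by simp
  qed

  define B where "B = (\<Sum>(a, b, c)\<in>N. ln (d a b c))"
  have G_ge: "B \<le> G t" if t: "\<And>p. 0 < t p" for t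
  proof -
    have "B + (\<Sum>(a, b, c)\<in>N. ln (t a * t b * t c)) = (\<Sum>(a, b, c)\<in>N. ln (t a * t b * t c * d a b c))"
      unfolding B_def sum.distrib [symmetric]
      using t by (intro sum.cong refl) (auto simp: N_def ln_mult_pos)
    also have "\<dots> \<le> (\<Sum>(a, b, c)\<in>N. ln (D t))"
    proof (intro sum_mono, clarify)
      fix a b c assume abc: "(a, b, c) \<in> N"
      then have "0 < t a * t b * t c * d a b c" using t by (auto simp: N_def)
      then show "ln (t a * t b * t c * d a b c) \<le> ln (D t)"
        using D_ge [of t, OF t abc] D_pos [of t, OF t] by simp
    qed
    also have "\<dots> = M * ln (D t)" by (simp add: M_def)
    finally show ?thesis by (simp add: G_def)
  qed

  define X where "X = G ` {t. \<forall>p. 0 < t p}"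
  have bdd: "bdd_below X" unfolding X_def using G_ge by (auto intro!: bdd_belowI)
  have Xne: "X \<noteq> {}" unfolding X_def by (auto intro!: exI [of _ "\<lambda>_. 1"])
  \<comment> \<open>The infimum need not be attained. The slack is affordable because 3 + 1/10 is
    below 16/5, which is 4 times the factor 4/5 in \<open>cardN\<close>.\<close>
  define \<epsilon> where "\<epsilon> = n\<^sup>2 / 10"
  have "\<epsilon> > 0" using n by (simp add: \<epsilon>_def)
  then have "\<exists>x\<in>X. x < Inf X + \<epsilon>"
    using cInf_lessD [OF Xne, of "Inf X + \<epsilon>"] by auto
  then obtain t where t: "\<And>p. 0 < t p" and near: "G t < Inf X + \<epsilon>"
    by (auto simp: X_def)

  have "3 * n * T t p \<le> 8 * D t" if p: "p \<in> S" for p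
  proof -
    define t' where "t' = t(p := t p / 2)"
    have t': "0 < t' q" for q using t by (simp add: t'_def)
    have "G t < G t' + \<epsilon>"
      using near cInf_lower [OF _ bdd, of "G t'"] t' by (auto simp: X_def)
    define h :: "'a \<Rightarrow> real" where "h q = (if q = p then 1 else 0)" for q
    \<comment> \<open>Terms with a repeated index vanish, so at most one factor of a nonzero term is
      halved and the change is linear in the indicators \<open>h\<close>.\<close>
    have halved: "t' a * t' b * t' c * d a b c
        = t a * t b * t c * d a b c - (h a + h b + h c) * (t a * t b * t c * d a b c) / 2" for a b c
    proof -
      have "d a b c = 0" if "a = b \<or> b = c \<or> a = c"
        using that same [of a c] sym(1) [of a b c] sym(2) [of a b c] same [of c b] same
        by (metis sym)
      then show ?thesis by (auto simp: t'_def h_def)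
    qed
    have Th: "(\<Sum>a\<in>S. \<Sum>b\<in>S. \<Sum>c\<in>S. h a * (t a * t b * t c * d a b c)) = T t p"
    proof -
      have "(\<Sum>a\<in>S. \<Sum>b\<in>S. \<Sum>c\<in>S. h a * (t a * t b * t c * d a b c)) = (\<Sum>a\<in>S. if a = p then T t a else 0)"
        by (intro sum.cong refl) (simp add: h_def T_def)
      then show ?thesis using p fin by simp
    qed
    \<comment> \<open>Symmetry of \<open>d\<close> moves the indicator from slot to slot, so all
      three slots contribute \<open>T t p\<close>.\<close>
    have Th2: "(\<Sum>a\<in>S. \<Sum>b\<in>S. \<Sum>c\<in>S. h b * (t a * t b * t c * d a b c)) = T t p"
      unfolding Th [symmetric]
      by (subst sum.swap, intro sum.cong refl) (simp add: sym(1) ac_simps)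
    have Th3: "(\<Sum>a\<in>S. \<Sum>b\<in>S. \<Sum>c\<in>S. h c * (t a * t b * t c * d a b c)) = T t p"
      unfolding Th2 [symmetric]
      by (rule sum.cong [OF refl], subst sum.swap, intro sum.cong refl) (simp add: sym(2) ac_simps)
    have "D t' = D t - (T t p + T t p + T t p) / 2"
      unfolding D_def halved
      by (subst Th [symmetric], subst Th2 [symmetric], subst Th3 [symmetric])
        (simp add: sum_subtractf sum.distrib add_divide_distrib distrib_right flip: sum_divide_distrib)
    then have D': "D t' = D t - 3 * T t p / 2" by simp
    \<comment> \<open>The fraction of \<open>D t\<close> lost by the halving. The claim is
      equivalent to \<open>n * x \<le> 4\<close>, and \<open>ln (1 - x) \<le> - x\<close> makes the
      gain in \<open>G\<close> linear in \<open>x\<close>.\<close>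
    define x where "x = 3 * T t p / (2 * D t)"
    have Dx: "D t' = D t * (1 - x)" using D_pos [of t, OF t] by (simp add: D' x_def field_simps)
    have "1 - x > 0" using D_pos [of t, OF t] D_pos [of t', OF t'] by (simp add: Dx zero_less_mult_iff)
    then have "ln (D t') \<le> ln (D t) - x"
      using D_pos [of t, OF t] ln_le_minus_one [of "1 - x"] by (simp add: Dx ln_mult_pos)
    then have 1: "M * ln (D t') \<le> M * ln (D t) - M * x"
      using Mpos by (metis less_imp_le mult_left_mono right_diff_distrib)

    have lnh: "ln (t' q) = ln (t q) - h q * ln 2" for q
      using t [of p] by (simp add: t'_def h_def ln_div)
    have "(\<Sum>(a, b, c)\<in>N. ln (t' a * t' b * t' c))
        = (\<Sum>(a, b, c)\<in>N. ln (t a * t b * t c) - (h a + h b + h c) * ln 2)"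
      using t t' by (intro sum.cong refl) (auto simp: ln_mult_pos lnh algebra_simps)
    also have "\<dots> = (\<Sum>(a, b, c)\<in>N. ln (t a * t b * t c)) - (\<Sum>(a, b, c)\<in>N. h a + h b + h c) * ln 2"
      by (simp add: case_prod_unfold sum_subtractf sum_distrib_right)
    finally have 2: "(\<Sum>(a, b, c)\<in>N. ln (t' a * t' b * t' c))
      = (\<Sum>(a, b, c)\<in>N. ln (t a * t b * t c)) - (\<Sum>(a, b, c)\<in>N. h a + h b + h c) * ln 2" .
    \<comment> \<open>The cost of the halving counts the occurrences of \<open>p\<close> in
      \<open>N\<close>. There are at most \<open>n\<^sup>2\<close> in each of the three slots, and
      \<open>ln 2\<close> is rounded up to 1 below.\<close>
    have "(\<Sum>(a, b, c)\<in>N. h a + h b + h c) \<le> (\<Sum>(a, b, c)\<in>S \<times> S \<times> S. h a + h b + h c)"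
      by (intro sum_mono2) (auto simp: fin N_def h_def)
    also have "\<dots> = 3 * n\<^sup>2"
      using p fin by (simp add: sum.cartesian_product [symmetric] sum.distrib h_def n_def
          power2_eq_square flip: sum_distrib_left)
    finally have 3: "(\<Sum>(a, b, c)\<in>N. h a + h b + h c) \<le> 3 * n\<^sup>2" .
    have "(\<Sum>(a, b, c)\<in>N. h a + h b + h c) * ln 2 \<le> 3 * n\<^sup>2 * 1"
      using 3 ln_2_less_1 by (intro mult_mono) auto
    then have "M * x \<le> 3 * n\<^sup>2 + \<epsilon>"
      using \<open>G t < G t' + \<epsilon>\<close> 1 2 unfolding G_def by linarith
    then have Mx: "M * x \<le> 3.1 * n\<^sup>2" by (simp add: \<epsilon>_def)
    have x0: "0 \<le> x"
      using D_pos [of t, OF t] t nn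
      by (auto simp: x_def T_def intro!: divide_nonneg_pos mult_nonneg_nonneg sum_nonneg less_imp_le [OF t])
    have "4 * n ^ 3 * x \<le> 5 * M * x" using M x0 by (intro mult_right_mono)
    also have "\<dots> \<le> 16 * n\<^sup>2" using Mx zero_le_power2 [of n] by linarith
    finally have "n * x * n\<^sup>2 \<le> 4 * n\<^sup>2" by (simp add: power3_eq_cube power2_eq_square ac_simps)
    then have "n * x \<le> 4" using n by simp
    then show ?thesis using D_pos [of t, OF t] by (simp add: x_def field_simps)
  qed
  then show thesis
    using that [of t, OF t] D_pos [of t, OF t] unfolding T_def D_def n_def by blast
qed

subsection \<open>The reproducing kernel of the affine functions\<close>

text \<open>Conjugating the first argument makes the form right linear in the second, matching the
  right coefficients of \<open>affs\<close>.\<close>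

definition ip :: "quat2 set \<Rightarrow> (quat2 \<Rightarrow> real) \<Rightarrow> (quat2 \<Rightarrow> quat) \<Rightarrow> (quat2 \<Rightarrow> quat) \<Rightarrow> quat" where
  "ip S t f g = (\<Sum>p\<in>S. t p *\<^sub>R (qcnj (f p) * g p))"

lemma ip_simps:
  "ip S t f (\<lambda>p. g p + h p) = ip S t f g + ip S t f h"
  "ip S t f (\<lambda>p. g p - h p) = ip S t f g - ip S t f h"
  "ip S t f (\<lambda>p. g p * c) = ip S t f g * c"
  "ip S t f (\<lambda>p. r *\<^sub>R g p) = r *\<^sub>R ip S t f g"
  "ip S t (\<lambda>p. r *\<^sub>R f p) g = r *\<^sub>R ip S t f g"
  by (simp_all add: ip_def algebra_simps sum.distrib sum_subtractf sum_distrib_right scaleR_right.sum)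

lemma qcnj_ip: "qcnj (ip S t f g) = ip S t g f"
  by (simp add: ip_def qcnj_sum)

lemma ip_same: "ip S t f f = of_real (\<Sum>p\<in>S. t p * qnorm2 (f p))"
  by (simp add: ip_def mult_qcnj of_real_def scaleR_sum_left)

text \<open>The spanning clause takes the place of a dimension count; the reproducing property rests
  on it.\<close>

definition orthonormal :: "quat2 set \<Rightarrow> (quat2 \<Rightarrow> real) \<Rightarrow> (quat2 \<Rightarrow> quat) \<Rightarrow> (quat2 \<Rightarrow> quat) \<Rightarrow> (quat2 \<Rightarrow> quat) \<Rightarrow> bool" where
  "orthonormal S t f g h \<longleftrightarrow> f \<in> affs \<and> g \<in> affs \<and> h \<in> affs
    \<and> ip S t f f = 1 \<and> ip S t g g = 1 \<and> ip S t h h = 1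
    \<and> ip S t f g = 0 \<and> ip S t f h = 0 \<and> ip S t g h = 0
    \<and> (\<forall>u\<in>affs. \<exists>A B C. \<forall>p. u p = f p * A + g p * B + h p * C)"

definition kernel :: "(quat2 \<Rightarrow> quat) \<Rightarrow> (quat2 \<Rightarrow> quat) \<Rightarrow> (quat2 \<Rightarrow> quat) \<Rightarrow> quat2 \<Rightarrow> quat2 \<Rightarrow> quat" where
  "kernel f g h p q = f p * qcnj (f q) + g p * qcnj (g q) + h p * qcnj (h q)"

lemma normalise:
  assumes "finite S" "\<And>p. 0 < t p" "p \<in> S" "f p \<noteq> 0"
  obtains r where "r \<noteq> 0" "ip S t (\<lambda>p. r *\<^sub>R f p) (\<lambda>p. r *\<^sub>R f p) = 1"
proof -
  define s where "s = (\<Sum>p\<in>S. t p * qnorm2 (f p))"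
  have "0 < t p * qnorm2 (f p)" using assms by simp
  also have "\<dots> \<le> s" unfolding s_def
    by (rule member_le_sum [where f = "\<lambda>p. t p * qnorm2 (f p)"]) (use assms in \<open>auto simp: less_imp_le\<close>)
  finally have "0 < s" .
  then show thesis
    by (intro that [of "1 / sqrt s"]) (simp_all add: ip_simps ip_same of_real_def flip: s_def)
qed

text \<open>Gram-Schmidt on the barycentric coordinates, started with \<open>ec\<close>: the first
  vector \<open>h\<close> is then a multiple of \<open>ec\<close> and vanishes on the line through
  \<open>a\<close> and \<open>b\<close>, as \<open>trace_line_le\<close> requires.\<close>

lemma orthonormal_exists:
  assumes fin: "finite S" and t: "\<And>p. 0 < t p" and S: "a \<in> S" "b \<in> S" "c \<in> S"
    and nc: "noncollinear a b c"
  obtains f g h where "orthonormal S t f g h" "\<And>p. p \<in> line_thru a b \<Longrightarrow> h p = 0"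
proof -
  obtain ea eb ec where bary: "barycentric a b c ea eb ec" using barycentric_exists [OF nc] .
  interpret barycentric a b c ea eb ec by (fact bary)
  have "ec c \<noteq> 0" by (simp add: val)
  then obtain r3 where r3: "r3 \<noteq> 0" and h1: "ip S t (\<lambda>p. r3 *\<^sub>R ec p) (\<lambda>p. r3 *\<^sub>R ec p) = 1"
    by (rule normalise [of S t c ec, OF fin t S(3)])
  define h where "h = (\<lambda>p. r3 *\<^sub>R ec p)"
  have hh: "ip S t h h = 1" using h1 by (simp add: h_def)
  have h: "h \<in> affs" unfolding h_def by (intro affs_intros affs)
  have hab: "h a = 0" "h b = 0" by (simp_all add: h_def val)

  define g0 where "g0 = (\<lambda>p. eb p - h p * ip S t h eb)"
  have g0: "g0 \<in> affs" unfolding g0_def by (intro affs_intros affs h)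
  have "ip S t h g0 = 0" by (simp add: g0_def ip_simps hh)
  \<comment> \<open>The functions already constructed vanish at the next vertex, so the correction
    keeps the value 1 there and normalisation is possible.\<close>
  have "g0 b \<noteq> 0" by (simp add: g0_def hab val)
  then obtain r2 where r2: "r2 \<noteq> 0" and g1: "ip S t (\<lambda>p. r2 *\<^sub>R g0 p) (\<lambda>p. r2 *\<^sub>R g0 p) = 1"
    by (rule normalise [of S t b g0, OF fin t S(2)])
  define g where "g = (\<lambda>p. r2 *\<^sub>R g0 p)"
  have gg: "ip S t g g = 1" using g1 by (simp add: g_def)
  have g: "g \<in> affs" unfolding g_def by (intro affs_intros g0)
  have hg: "ip S t h g = 0" using \<open>ip S t h g0 = 0\<close> by (simp add: g_def ip_simps)
  then have gh: "ip S t g h = 0" using qcnj_ip [of S t h g] by simp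
  have ga: "g a = 0" by (simp add: g_def g0_def hab val)

  define f0 where "f0 = (\<lambda>p. ea p - g p * ip S t g ea - h p * ip S t h ea)"
  have f0: "f0 \<in> affs" unfolding f0_def by (intro affs_intros affs g h)
  have gf0: "ip S t g f0 = 0" "ip S t h f0 = 0" by (simp_all add: f0_def ip_simps hh gg gh hg)
  have "f0 a \<noteq> 0" by (simp add: f0_def hab ga val)
  then obtain r1 where r1: "r1 \<noteq> 0" and f1: "ip S t (\<lambda>p. r1 *\<^sub>R f0 p) (\<lambda>p. r1 *\<^sub>R f0 p) = 1"
    by (rule normalise [of S t a f0, OF fin t S(1)])
  define f where "f = (\<lambda>p. r1 *\<^sub>R f0 p)"
  have ff: "ip S t f f = 1" using f1 by (simp add: f_def)
  have f: "f \<in> affs" unfolding f_def by (intro affs_intros f0)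
  have "ip S t g f = 0" "ip S t h f = 0" using gf0 by (simp_all add: f_def ip_simps)
  then have fgh: "ip S t f g = 0" "ip S t f h = 0" using qcnj_ip [of S t g f] qcnj_ip [of S t h f] by simp_all

  \<comment> \<open>Inverting the triangular change of basis shows that \<open>f\<close>,
    \<open>g\<close>, \<open>h\<close> still span.\<close>
  have ec_eq: "ec p = h p * ((1 / r3) *\<^sub>R 1)" for p using r3 by (simp add: h_def)
  have eb_eq: "eb p = g p * ((1 / r2) *\<^sub>R 1) + h p * ip S t h eb" for p
    using r2 by (simp add: g_def g0_def)
  have ea_eq: "ea p = f p * ((1 / r1) *\<^sub>R 1) + g p * ip S t g ea + h p * ip S t h ea" for p
    using r1 by (simp add: f_def f0_def)
  have regroup: "(f' * i + g' * k + h' * l) * x + (g' * j + h' * m) * y + h' * o' * z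
      = f' * (i * x) + g' * (k * x + j * y) + h' * (l * x + m * y + o' * z)"
    for f' g' h' i j k l m o' x y z :: quat
    by (simp add: algebra_simps)
  have span: "\<exists>A B C. \<forall>p. u p = f p * A + g p * B + h p * C" if "u \<in> affs" for u
  proof (intro exI allI)
    fix p
    have "u p = ea p * u a + eb p * u b + ec p * u c" by (rule expand [OF that])
    also have "\<dots> = f p * (((1 / r1) *\<^sub>R 1) * u a)
        + g p * (ip S t g ea * u a + ((1 / r2) *\<^sub>R 1) * u b)
        + h p * (ip S t h ea * u a + ip S t h eb * u b + ((1 / r3) *\<^sub>R 1) * u c)"
      unfolding ec_eq [of p] eb_eq [of p] ea_eq [of p] by (rule regroup)
    finally show "u p = f p * (((1 / r1) *\<^sub>R 1) * u a)
        + g p * (ip S t g ea * u a + ((1 / r2) *\<^sub>R 1) * u b)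
        + h p * (ip S t h ea * u a + ip S t h eb * u b + ((1 / r3) *\<^sub>R 1) * u c)" .
  qed
  have "orthonormal S t f g h"
    unfolding orthonormal_def by (intro conjI ballI f g h ff gg hh fgh gh span)
  moreover have "h p = 0" if "p \<in> line_thru a b" for p
    using affs_eq_0_on_line [OF h hab that] .
  ultimately show thesis by (rule that)
qed

locale affine_kernel =
  fixes S t f g h
  assumes on: "orthonormal S t f g h"
begin

abbreviation "K \<equiv> kernel f g h"

lemma qcnj_kernel: "qcnj (K p q) = K q p"
  by (simp add: kernel_def)

lemma kernel_affs: "(\<lambda>p. K p q) \<in> affs"
  using on unfolding orthonormal_def kernel_def by (intro affs_intros) auto

lemma kernel_reproducing:
  assumes "u \<in> affs"
  shows "u p = (\<Sum>q\<in>S. t q *\<^sub>R (K p q * u q))"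
proof -
  obtain A B C where u: "\<And>p. u p = f p * A + g p * B + h p * C"
    using on assms unfolding orthonormal_def by metis
  have ips: "ip S t f f = 1" "ip S t g g = 1" "ip S t h h = 1"
    "ip S t f g = 0" "ip S t f h = 0" "ip S t g h = 0"
    using on unfolding orthonormal_def by auto
  then have ips': "ip S t g f = 0" "ip S t h f = 0" "ip S t h g = 0"
    using qcnj_ip [of S t f g] qcnj_ip [of S t f h] qcnj_ip [of S t g h] by simp_all
  have ueq: "u = (\<lambda>p. f p * A + g p * B + h p * C)" using u by auto
  have "(\<Sum>q\<in>S. t q *\<^sub>R (K p q * u q)) = f p * ip S t f u + g p * ip S t g u + h p * ip S t h u"
    by (simp add: kernel_def ip_def sum_distrib_left sum.distrib algebra_simps scaleR_right.sum)
  also have "\<dots> = u p"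
    by (simp add: ueq ip_simps ips ips')
  finally show ?thesis by simp
qed

lemma kernel_diag: "K p p = of_real (qnorm2 (f p) + qnorm2 (g p) + qnorm2 (h p))"
  by (simp add: kernel_def mult_qcnj)

text \<open>The kernel reproduces its own column at \<open>p\<close>; evaluate that column at
  \<open>p\<close>.\<close>

lemma sum_qnorm2_kernel: "(\<Sum>q\<in>S. t q * qnorm2 (K p q)) = qre (K p p)"
proof -
  have "K p p = (\<Sum>q\<in>S. t q *\<^sub>R (K p q * K q p))"
    by (rule kernel_reproducing [OF kernel_affs])
  also have "\<dots> = (\<Sum>q\<in>S. t q *\<^sub>R (K p q * qcnj (K p q)))"
    by (simp add: qcnj_kernel)
  finally have "K p p = (\<Sum>q\<in>S. t q *\<^sub>R (K p q * qcnj (K p q)))" .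
  from arg_cong [OF this, of qre] show ?thesis by (simp add: qre_sum mult_qcnj)
qed

text \<open>The trace of a projection is its rank: each of the three unit vectors contributes
  1.\<close>

lemma sum_trace_kernel: "(\<Sum>p\<in>S. t p * qre (K p p)) = 3"
proof -
  have "qre (ip S t f f + ip S t g g + ip S t h h) = 3"
    using on unfolding orthonormal_def qre_simps by simp
  then show ?thesis
    unfolding ip_same qre_simps qre_of_real kernel_diag
    by (simp add: algebra_simps sum.distrib)
qed

text \<open>Each kernel reproduces the columns of the other. Hence the basis may be adapted to each
  line separately without changing \<open>K\<close>.\<close>

lemma kernel_unique:
  assumes "affine_kernel S t f' g' h'"
  shows "kernel f' g' h' = K"
proof (intro ext)
  fix p q
  interpret k: affine_kernel S t f' g' h' by fact
  have "k.K p q = (\<Sum>r\<in>S. t r *\<^sub>R (K p r * k.K r q))"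
    by (rule kernel_reproducing [OF k.kernel_affs])
  also have "\<dots> = qcnj (\<Sum>r\<in>S. t r *\<^sub>R (k.K q r * K r p))"
    by (simp add: qcnj_sum qcnj_kernel k.qcnj_kernel)
  also have "\<dots> = qcnj (K q p)"
    by (rule arg_cong [OF k.kernel_reproducing [OF kernel_affs], symmetric])
  finally show "k.K p q = K p q" by (simp add: qcnj_kernel)
qed

text \<open>Where \<open>h\<close> vanishes, the kernel is a Gram matrix of rank at most 2, so this is Cauchy-Schwarz.\<close>

lemma trace_line_le:
  assumes h0: "\<And>p. p \<in> P \<Longrightarrow> h p = 0"
  shows "(\<Sum>p\<in>P. t p * qre (K p p))\<^sup>2 \<le> 2 * (\<Sum>p\<in>P. \<Sum>q\<in>P. t p * t q * qnorm2 (K p q))"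
proof -
  \<comment> \<open>\<open>F\<close>, \<open>G\<close> and \<open>X\<close> are the entries of the 2
    by 2 Gram matrix of \<open>g\<close> and \<open>f\<close> over \<open>P\<close>. The double sum
    is its squared Hilbert-Schmidt norm, from which the part of \<open>X\<close> is dropped.\<close>
  define F where "F = (\<Sum>p\<in>P. t p * qnorm2 (f p))"
  define G where "G = (\<Sum>p\<in>P. t p * qnorm2 (g p))"
  define X where "X = (\<Sum>p\<in>P. t p *\<^sub>R (qcnj (g p) * f p))"
  have K2: "qnorm2 (K p q) = qnorm2 (f p) * qnorm2 (f q) + qnorm2 (g p) * qnorm2 (g q)
      + 2 * qre ((qcnj (g p) * f p) * qcnj (qcnj (g q) * f q))" if "p \<in> P" "q \<in> P" for p q
  proof -
    have "qre (f p * qcnj (f q) * qcnj (g p * qcnj (g q)))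
        = qre ((f p * qcnj (f q) * g q) * qcnj (g p))" by (simp add: mult.assoc)
    also have "\<dots> = qre (qcnj (g p) * (f p * qcnj (f q) * g q))" by (rule qre_mult_commute)
    finally show ?thesis
      using h0 that by (simp add: kernel_def qnorm2_add qnorm2_mult mult.assoc)
  qed
  have "(\<Sum>p\<in>P. \<Sum>q\<in>P. t p * t q * qnorm2 (K p q))
      = (\<Sum>p\<in>P. \<Sum>q\<in>P. (t p * qnorm2 (f p)) * (t q * qnorm2 (f q))
          + (t p * qnorm2 (g p)) * (t q * qnorm2 (g q))
          + 2 * qre ((t p *\<^sub>R (qcnj (g p) * f p)) * qcnj (t q *\<^sub>R (qcnj (g q) * f q))))"
    by (intro sum.cong refl) (simp add: K2 algebra_simps)
  also have "\<dots> = F * F + G * G + 2 * qre (X * qcnj X)"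
    unfolding F_def G_def X_def qcnj_sum sum_product
    by (simp add: sum.distrib qre_sum sum_distrib_left)
  finally have "(\<Sum>p\<in>P. \<Sum>q\<in>P. t p * t q * qnorm2 (K p q)) \<ge> F * F + G * G"
    by (simp add: mult_qcnj)
  moreover have "(\<Sum>p\<in>P. t p * qre (K p p)) = F + G"
    using h0 by (simp add: F_def G_def kernel_diag algebra_simps sum.distrib)
  moreover have "(F + G)\<^sup>2 \<le> 2 * (F * F + G * G)"
    using sum_squares_bound [of F G] by (simp add: power2_eq_square algebra_simps)
  ultimately show ?thesis by simp
qed

end

subsection \<open>Summation over the lines of a finite linear space\<close>

text \<open>The strict bound in \<open>card_line\<close> leaves at least \<open>k\<close> points on
  a line besides any given one.\<close>

locale linear_space =
  fixes S :: "'a set" and \<L> :: "'a set set" and k :: nat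
  assumes fin: "finite S"
    and lines: "P \<in> \<L> \<Longrightarrow> P \<subseteq> S"
    and line_exists: "p \<in> S \<Longrightarrow> q \<in> S \<Longrightarrow> p \<noteq> q \<Longrightarrow> \<exists>P\<in>\<L>. p \<in> P \<and> q \<in> P"
    and line_unique: "P \<in> \<L> \<Longrightarrow> Q \<in> \<L> \<Longrightarrow> p \<noteq> q \<Longrightarrow> p \<in> P \<Longrightarrow> q \<in> P \<Longrightarrow> p \<in> Q \<Longrightarrow> q \<in> Q \<Longrightarrow> P = Q"
    and card_line: "P \<in> \<L> \<Longrightarrow> k < card P"
begin

definition pencil :: "'a \<Rightarrow> 'a set set" where "pencil p = {P \<in> \<L>. p \<in> P}"

lemma finite_lines: "finite \<L>"
  by (rule finite_subset [of _ "Pow S"]) (use lines fin in auto)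

lemma finite_line: "P \<in> \<L> \<Longrightarrow> finite P"
  using lines fin finite_subset by blast

lemma finite_pencil: "finite (pencil p)"
  using finite_lines by (simp add: pencil_def)

text \<open>The lines through \<open>p\<close> are disjoint away from \<open>p\<close>, and each has
  at least \<open>k\<close> further points.\<close>

lemma card_pencil_le:
  assumes "p \<in> S"
  shows "k * card (pencil p) \<le> card S - 1"
proof -
  have "k * card (pencil p) = (\<Sum>P\<in>pencil p. k)" by simp
  also have "\<dots> \<le> (\<Sum>P\<in>pencil p. card (P - {p}))"
    using card_line finite_line by (intro sum_mono) (fastforce simp: pencil_def)
  also have "\<dots> = card (\<Union>P\<in>pencil p. P - {p})"
  proof (rule card_UN_disjoint [symmetric])
    have "q = p" if "P \<in> pencil p" "Q \<in> pencil p" "P \<noteq> Q" "q \<in> P" "q \<in> Q" for P Q q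
      using that line_unique [of P Q q p] by (auto simp: pencil_def)
    then show "\<forall>P\<in>pencil p. \<forall>Q\<in>pencil p. P \<noteq> Q \<longrightarrow> (P - {p}) \<inter> (Q - {p}) = {}"
      by blast
  qed (use finite_pencil finite_line in \<open>auto simp: pencil_def\<close>)
  also have "\<dots> \<le> card (S - {p})"
    using lines fin by (intro card_mono) (auto simp: pencil_def)
  finally show ?thesis using assms fin by simp
qed

text \<open>Joining \<open>c\<close> to the points of \<open>Q\<close> gives distinct lines through
  \<open>c\<close>, since a line with two points of \<open>Q\<close> is \<open>Q\<close> itself. Now
  apply \<open>card_pencil_le\<close> at \<open>c\<close>.\<close>

lemma card_line_le:
  assumes "Q \<in> \<L>" "c \<in> S" "c \<notin> Q"
  shows "k * card Q \<le> card S - 1"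
proof -
  have "\<exists>P. P \<in> \<L> \<and> c \<in> P \<and> q \<in> P" if "q \<in> Q" for q
    using line_exists [of c q] assms lines that by blast
  then obtain l where l: "\<And>q. q \<in> Q \<Longrightarrow> l q \<in> \<L> \<and> c \<in> l q \<and> q \<in> l q" by metis
  have "inj_on l Q"
    using l assms line_unique by (intro inj_onI) metis
  then have "card Q \<le> card (pencil c)"
    using l by (intro card_inj_on_le [of l] finite_pencil) (auto simp: pencil_def)
  then show ?thesis using card_pencil_le [OF assms(2)] by (meson le_trans mult_le_mono2)
qed

definition off_diag :: "'a set \<Rightarrow> ('a \<times> 'a) set" where
  "off_diag P = {(p, q). p \<in> P \<and> q \<in> P \<and> p \<noteq> q}"

lemma sum_off_diag:
  fixes c :: "'a \<Rightarrow> 'a \<Rightarrow> real"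
  assumes "finite P"
  shows "(\<Sum>p\<in>P. \<Sum>q\<in>P. c p q) = (\<Sum>(p, q)\<in>off_diag P. c p q) + (\<Sum>p\<in>P. c p p)"
proof -
  have f: "finite (off_diag P)"
    by (rule finite_subset [of _ "P \<times> P"]) (auto simp: off_diag_def assms)
  have "(\<Sum>p\<in>P. \<Sum>q\<in>P. c p q) = (\<Sum>(p, q)\<in>P \<times> P. c p q)"
    by (simp add: sum.cartesian_product)
  also have "P \<times> P = off_diag P \<union> (\<lambda>p. (p, p)) ` P" by (auto simp: off_diag_def)
  also have "(\<Sum>(p, q)\<in>\<dots>. c p q) = (\<Sum>(p, q)\<in>off_diag P. c p q) + (\<Sum>(p, q)\<in>(\<lambda>p. (p, p)) ` P. c p q)"
    using assms f by (intro sum.union_disjoint) (auto simp: off_diag_def)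
  also have "(\<Sum>(p, q)\<in>(\<lambda>p. (p, p)) ` P. c p q) = (\<Sum>p\<in>P. c p p)"
    by (subst sum.reindex) (auto simp: inj_on_def)
  finally show ?thesis .
qed

text \<open>The lines partition the ordered pairs of distinct points.\<close>

lemma sum_lines_off_diag:
  fixes c :: "'a \<Rightarrow> 'a \<Rightarrow> real"
  shows "(\<Sum>P\<in>\<L>. \<Sum>(p, q)\<in>off_diag P. c p q) = (\<Sum>(p, q)\<in>off_diag S. c p q)"
proof -
  have "finite (off_diag P)" if "P \<in> \<L>" for P
    by (rule finite_subset [of _ "P \<times> P"]) (auto simp: off_diag_def finite_line that)
  moreover have "off_diag S = (\<Union>P\<in>\<L>. off_diag P)"
    using lines line_exists by (fastforce simp: off_diag_def)
  moreover have "off_diag P \<inter> off_diag Q = {}" if "P \<in> \<L>" "Q \<in> \<L>" "P \<noteq> Q" for P Q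
    using that line_unique [OF that(1,2)] by (auto simp: off_diag_def)
  ultimately show ?thesis
    by (simp add: sum.UNION_disjoint finite_lines)
qed

lemma sum_lines:
  fixes w :: "'a \<Rightarrow> real"
  shows "(\<Sum>P\<in>\<L>. \<Sum>p\<in>P. w p) = (\<Sum>p\<in>S. real (card (pencil p)) * w p)"
proof -
  have "(\<Sum>P\<in>\<L>. \<Sum>p\<in>P. w p) = (\<Sum>P\<in>\<L>. \<Sum>p\<in>S. if p \<in> P then w p else 0)"
    using lines fin by (intro sum.cong [OF refl]) (simp add: sum.inter_restrict [symmetric] Int_absorb1)
  also have "\<dots> = (\<Sum>p\<in>S. \<Sum>P\<in>\<L>. if p \<in> P then w p else 0)" by (rule sum.swap)
  also have "\<dots> = (\<Sum>p\<in>S. real (card (pencil p)) * w p)"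
    by (intro sum.cong refl) (simp add: pencil_def finite_lines flip: sum.inter_filter)
  finally show ?thesis .
qed

text \<open>Otherwise \<open>card_pencil_le\<close> yields
  \<open>card (pencil p) * \<tau> p \<le> 1\<close> wherever \<open>\<tau> p\<close> is nonzero.
  With Q the sum of the squares of \<open>\<tau>\<close>, summing over lines gives 9 - Q \<le> 2 *
  (3 - Q) + 3, so Q = 0, against the sum 3.\<close>

lemma rank_3_kernel_diag_large:
  fixes c :: "'a \<Rightarrow> 'a \<Rightarrow> real" and \<tau> :: "'a \<Rightarrow> real"
  assumes \<tau>: "\<And>p. p \<in> S \<Longrightarrow> 0 \<le> \<tau> p" "(\<Sum>p\<in>S. \<tau> p) = 3"
    and c: "(\<Sum>p\<in>S. \<Sum>q\<in>S. c p q) = 3" "\<And>p. c p p = (\<tau> p)\<^sup>2"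
    and line: "\<And>P. P \<in> \<L> \<Longrightarrow> (\<Sum>p\<in>P. \<tau> p)\<^sup>2 \<le> 2 * (\<Sum>p\<in>P. \<Sum>q\<in>P. c p q)"
  shows "\<exists>p\<in>S. real k < real (card S) * \<tau> p"
proof (rule ccontr)
  assume "\<not> ?thesis"
  then have small: "real (card S) * \<tau> p \<le> real k" if "p \<in> S" for p using that by force
  have "(\<Sum>(p, q)\<in>off_diag P. \<tau> p * \<tau> q) \<le> 2 * (\<Sum>(p, q)\<in>off_diag P. c p q) + (\<Sum>p\<in>P. (\<tau> p)\<^sup>2)"
    if "P \<in> \<L>" for P
    using line [OF that] sum_off_diag [OF finite_line [OF that], of c]
      sum_off_diag [OF finite_line [OF that], of "\<lambda>p q. \<tau> p * \<tau> q"]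
    by (simp add: c power2_eq_square sum_product)
  then have "(\<Sum>P\<in>\<L>. \<Sum>(p, q)\<in>off_diag P. \<tau> p * \<tau> q)
      \<le> (\<Sum>P\<in>\<L>. 2 * (\<Sum>(p, q)\<in>off_diag P. c p q) + (\<Sum>p\<in>P. (\<tau> p)\<^sup>2))"
    by (rule sum_mono)
  then have "(\<Sum>(p, q)\<in>off_diag S. \<tau> p * \<tau> q)
      \<le> 2 * (\<Sum>(p, q)\<in>off_diag S. c p q) + (\<Sum>p\<in>S. real (card (pencil p)) * (\<tau> p)\<^sup>2)"
    by (simp add: sum.distrib sum_lines_off_diag sum_lines flip: sum_distrib_left)
  moreover have "(\<Sum>(p, q)\<in>off_diag S. \<tau> p * \<tau> q) = 9 - (\<Sum>p\<in>S. (\<tau> p)\<^sup>2)"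
    using sum_off_diag [OF fin, of "\<lambda>p q. \<tau> p * \<tau> q"] \<tau>(2)
    by (simp add: power2_eq_square flip: sum_product)
  moreover have "(\<Sum>(p, q)\<in>off_diag S. c p q) = 3 - (\<Sum>p\<in>S. (\<tau> p)\<^sup>2)"
    using sum_off_diag [OF fin, of c] by (simp add: c)
  moreover have "(\<Sum>p\<in>S. real (card (pencil p)) * (\<tau> p)\<^sup>2) \<le> (\<Sum>p\<in>S. \<tau> p)"
  proof (rule sum_mono)
    fix p assume p: "p \<in> S"
    have "real k * (real (card (pencil p)) * \<tau> p) \<le> real (card S) * \<tau> p"
    proof -
      have "k * card (pencil p) \<le> card S" using card_pencil_le [OF p] by simp
      then have "real k * real (card (pencil p)) \<le> real (card S)"
        by (metis of_nat_le_iff of_nat_mult)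
      then show ?thesis using mult_right_mono \<tau>(1) [OF p] by (metis mult.assoc)
    qed
    also have "\<dots> \<le> real k" by (rule small [OF p])
    finally have *: "real k * (real (card (pencil p)) * \<tau> p) \<le> real k * 1" by simp
    \<comment> \<open>For \<open>k = 0\<close> the factor \<open>k\<close> cannot be cancelled, but
      then the assumed bound forces \<open>\<tau> p = 0\<close>.\<close>
    have "real (card (pencil p)) * \<tau> p \<le> 1 \<or> \<tau> p = 0"
    proof (cases "k = 0")
      case True
      have "0 < card S" using p fin card_gt_0_iff by blast
      then have "\<tau> p \<le> 0" using small [OF p] True by (simp add: mult_le_0_iff)
      then show ?thesis using \<tau>(1) [OF p] by simp
    next
      case False
      then show ?thesis using * by (simp del: mult_1_right)
    qed
    then have "(real (card (pencil p)) * \<tau> p) * \<tau> p \<le> 1 * \<tau> p"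
      using \<tau>(1) [OF p] mult_right_mono by fastforce
    then show "real (card (pencil p)) * (\<tau> p)\<^sup>2 \<le> \<tau> p"
      by (simp add: power2_eq_square mult.assoc)
  qed
  ultimately have "(\<Sum>p\<in>S. (\<tau> p)\<^sup>2) \<le> 0" using \<tau>(2) by simp
  then have "(\<Sum>p\<in>S. (\<tau> p)\<^sup>2) = 0" by (meson antisym sum_nonneg zero_le_power2)
  then have "\<forall>p\<in>S. \<tau> p = 0" using fin by (simp add: sum_nonneg_eq_0_iff)
  then show False using \<tau>(2) by simp
qed

end

subsection \<open>Lines with few points\<close>

text \<open>Sum \<open>qnorm2_affs_area2_le\<close> over all triples with weights. By relabelling,
  its three terms each become \<open>M * T\<close>, and the balance condition bounds
  \<open>n * (9 * M * T)\<close> by \<open>24 * M * D\<close>.\<close>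

lemma affs_le_of_area2_balanced:
  assumes f: "f \<in> affs" and t: "\<And>p. 0 < t p"
    and bal: "3 * n * (\<Sum>b\<in>S. \<Sum>c\<in>S. t p * t b * t c * area2 p b c)
       \<le> 8 * (\<Sum>a\<in>S. \<Sum>b\<in>S. \<Sum>c\<in>S. t a * t b * t c * area2 a b c)"
    and pos: "0 < (\<Sum>a\<in>S. \<Sum>b\<in>S. \<Sum>c\<in>S. t a * t b * t c * area2 a b c)"
    and n: "0 \<le> n"
  shows "n * (t p * qnorm2 (f p)) \<le> 24 * (\<Sum>q\<in>S. t q * qnorm2 (f q))"
proof -
  define M where "M = (\<Sum>q\<in>S. t q * qnorm2 (f q))"
  define D where "D = (\<Sum>a\<in>S. \<Sum>b\<in>S. \<Sum>c\<in>S. t a * t b * t c * area2 a b c)"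
  define T where "T = (\<Sum>b\<in>S. \<Sum>c\<in>S. t p * t b * t c * area2 p b c)"
  have M0: "0 \<le> M" using t by (simp add: M_def sum_nonneg less_imp_le)
  have 1: "(\<Sum>a\<in>S. \<Sum>b\<in>S. \<Sum>c\<in>S. (t a * qnorm2 (f a)) * (t p * t b * t c * area2 p b c)) = M * T"
    unfolding M_def T_def sum_distrib_right by (simp add: sum_distrib_left)
  have 2: "(\<Sum>a\<in>S. \<Sum>b\<in>S. \<Sum>c\<in>S. (t b * qnorm2 (f b)) * (t p * t a * t c * area2 p a c)) = M * T"
    unfolding 1 [symmetric] by (rule sum.swap)
  have 3: "(\<Sum>a\<in>S. \<Sum>b\<in>S. \<Sum>c\<in>S. (t c * qnorm2 (f c)) * (t p * t a * t b * area2 p a b)) = M * T"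
    unfolding 2 [symmetric] by (rule sum.cong [OF refl], rule sum.swap)
  have "t p * qnorm2 (f p) * D
      = (\<Sum>a\<in>S. \<Sum>b\<in>S. \<Sum>c\<in>S. (t p * t a * t b * t c) * (qnorm2 (f p) * area2 a b c))"
    by (simp add: D_def sum_distrib_left ac_simps)
  also have "\<dots> \<le> (\<Sum>a\<in>S. \<Sum>b\<in>S. \<Sum>c\<in>S. (t p * t a * t b * t c)
      * (3 * (qnorm2 (f a) * area2 p b c + qnorm2 (f b) * area2 p a c + qnorm2 (f c) * area2 p a b)))"
    using t by (intro sum_mono mult_left_mono qnorm2_affs_area2_le f) (simp add: less_imp_le)
  also have "\<dots> = 3 * ((\<Sum>a\<in>S. \<Sum>b\<in>S. \<Sum>c\<in>S. (t a * qnorm2 (f a)) * (t p * t b * t c * area2 p b c))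
      + (\<Sum>a\<in>S. \<Sum>b\<in>S. \<Sum>c\<in>S. (t b * qnorm2 (f b)) * (t p * t a * t c * area2 p a c))
      + (\<Sum>a\<in>S. \<Sum>b\<in>S. \<Sum>c\<in>S. (t c * qnorm2 (f c)) * (t p * t a * t b * area2 p a b)))"
    unfolding sum.distrib [symmetric] sum_distrib_left
    by (intro sum.cong refl) (simp add: algebra_simps)
  also have "\<dots> = 9 * M * T" unfolding 1 2 3 by simp
  finally have "t p * qnorm2 (f p) * D \<le> 9 * M * T" .
  then have "n * (t p * qnorm2 (f p)) * D \<le> n * (9 * M * T)"
    using n by (metis mult.assoc mult_left_mono)
  also have "\<dots> = 3 * M * (3 * n * T)" by simp
  also have "\<dots> \<le> 3 * M * (8 * D)"
    using bal M0 unfolding D_def T_def by (intro mult_left_mono) auto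
  finally have "n * (t p * qnorm2 (f p)) * D \<le> 24 * M * D" by simp
  then show ?thesis using pos unfolding D_def [symmetric] M_def [symmetric] by simp
qed

theorem theorem2:
  fixes S :: "quat2 set"
  assumes "finite S"
    and "\<not> (\<exists>L. is_line L \<and> S \<subseteq> L)"
  shows "\<exists>L. is_line L \<and> 2 \<le> card (S \<inter> L) \<and> card (S \<inter> L) \<le> 24"
proof (rule ccontr)
  assume "\<not> ?thesis"
  then have rich: "24 < card (S \<inter> L)" if "is_line L" "2 \<le> card (S \<inter> L)" for L
    using that by force
  have two: "2 \<le> card (S \<inter> L)" if "p \<in> S" "q \<in> S" "p \<noteq> q" "p \<in> L" "q \<in> L" for p q L
    using card_mono [of "S \<inter> L" "{p, q}"] assms(1) that by simp
  define \<L> where "\<L> = {S \<inter> L | L. is_line L \<and> 2 \<le> card (S \<inter> L)}"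
  have line_thru: "S \<inter> line_thru p q \<in> \<L>" if "p \<in> S" "q \<in> S" "p \<noteq> q" for p q
    unfolding \<L>_def using two [OF that mem_line_thru] is_line_line_thru [OF that(3)] by blast
  interpret linear_space S \<L> 24
  proof
    show "finite S" by fact
    show "P \<subseteq> S" "24 < card P" if "P \<in> \<L>" for P
    proof -
      obtain L where "is_line L" "2 \<le> card (S \<inter> L)" "P = S \<inter> L"
        using \<open>P \<in> \<L>\<close> unfolding \<L>_def by blast
      then show "P \<subseteq> S" "24 < card P" using rich by simp_all
    qed
    show "\<exists>P\<in>\<L>. p \<in> P \<and> q \<in> P" if "p \<in> S" "q \<in> S" "p \<noteq> q" for p q
      using line_thru [OF that] that by (intro bexI [of _ "S \<inter> line_thru p q"]) simp_all
    show "P = Q" if "P \<in> \<L>" "Q \<in> \<L>" "p \<noteq> q" "p \<in> P" "q \<in> P" "p \<in> Q" "q \<in> Q" for P Q p q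
    proof -
      obtain L M where "is_line L" "is_line M" "P = S \<inter> L" "Q = S \<inter> M"
        using \<open>P \<in> \<L>\<close> \<open>Q \<in> \<L>\<close> unfolding \<L>_def by blast
      then show ?thesis using that is_line_eq_line_thru [of L p q] is_line_eq_line_thru [of M p q] by simp
    qed
  qed
  have off: "\<exists>c\<in>S. c \<notin> L" if "is_line L" for L
    using assms(2) that by blast

  obtain a b where ab: "a \<in> S" "b \<in> S" "a \<noteq> b"
  proof -
    \<comment> \<open>A line through a point in an arbitrary direction shows that \<open>S\<close>
      is neither empty nor a singleton.\<close>
    have "(0::quat2) \<noteq> (1, 0)" by (simp add: zero_prod_def)
    then have L: "is_line (line_thru p (p + (1, 0)))" for p by (intro is_line_line_thru) simp
    obtain a where a: "a \<in> S" using off [OF L] by blast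
    obtain b where "b \<in> S" "b \<notin> line_thru a (a + (1, 0))" using off [OF L] by blast
    then show thesis using that [OF a] by (metis mem_line_thru(1))
  qed
  obtain c where c: "c \<in> S" "noncollinear a b c"
    using off [OF is_line_line_thru [OF ab(3)]] ab by (auto simp: noncollinear_def)

  define n where "n = card S"
  have n25: "25 \<le> n"
    using card_line [OF line_thru [OF ab]] card_mono [OF fin, of "S \<inter> line_thru a b"]
    by (simp add: n_def)
  define N where "N = {(a, b, c). a \<in> S \<and> b \<in> S \<and> c \<in> S \<and> 0 < area2 a b c}"
  have N_eq: "N = Sigma S (\<lambda>a. Sigma (S - {a}) (\<lambda>b. S - line_thru a b))"
    by (auto simp: N_def area2_pos_iff noncollinear_def)
  \<comment> \<open>By \<open>card_line_le\<close> a line takes up less than 1/24 of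
    \<open>S\<close>, so most triples are noncollinear.\<close>
  have large: "23 * n \<le> 24 * card (S - line_thru p q)" if "p \<in> S" "q \<in> S" "p \<noteq> q" for p q
  proof -
    obtain r where "r \<in> S" "r \<notin> line_thru p q" using off is_line_line_thru \<open>p \<noteq> q\<close> by metis
    then have "24 * card (S \<inter> line_thru p q) \<le> n - 1"
      using card_line_le [OF line_thru [OF that]] by (auto simp: n_def)
    moreover have "card (S - line_thru p q) = n - card (S \<inter> line_thru p q)"
      using card_Diff_subset_Int [of S "line_thru p q"] fin by (simp add: n_def)
    ultimately show ?thesis by simp
  qed
  have "n * ((n - 1) * (23 * n)) = (\<Sum>p\<in>S. \<Sum>q\<in>S - {p}. 23 * n)"
    using fin by (simp add: n_def)
  also have "\<dots> \<le> (\<Sum>p\<in>S. \<Sum>q\<in>S - {p}. 24 * card (S - line_thru p q))"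
    by (intro sum_mono large) auto
  also have "\<dots> = 24 * card N"
    unfolding N_eq using fin by (simp add: card_SigmaI sum_distrib_left)
  finally have "real (n * ((n - 1) * (23 * n))) \<le> real (24 * card N)"
    by (simp only: of_nat_le_iff)
  moreover have "real (n - 1) = real n - 1" using n25 by simp
  ultimately have "23 * real n * real n * (real n - 1) \<le> 24 * real (card N)"
    by (simp add: ac_simps)
  \<comment> \<open>From 25 points on, n - 1 is at least 24/25 of n, so the noncollinear triples
    make up at least 23/25 of all; 4/5 suffices.\<close>
  moreover have "23 * real n * real n * (24 / 25 * real n) \<le> 23 * real n * real n * (real n - 1)"
    using n25 by (intro mult_left_mono) auto
  ultimately have cardN: "4 * real (card S) ^ 3 \<le> 5 * real (card N)"
    using zero_le_power [of "real n" 3] by (simp add: n_def power3_eq_cube)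

  have "\<exists>t. (\<forall>p. 0 < t p)
    \<and> 0 < (\<Sum>a\<in>S. \<Sum>b\<in>S. \<Sum>c\<in>S. t a * t b * t c * area2 a b c) \<and> (\<forall>p\<in>S.
      3 * real (card S) * (\<Sum>b\<in>S. \<Sum>c\<in>S. t p * t b * t c * area2 p b c)
       \<le> 8 * (\<Sum>a\<in>S. \<Sum>b\<in>S. \<Sum>c\<in>S. t a * t b * t c * area2 a b c))"
  proof (rule tensor_scaling [of S area2])
    show "finite S" "S \<noteq> {}" using fin ab by auto
    show "0 \<le> area2 a b c" "area2 a a b = 0" for a b c by simp_all
    show "area2 a b c = area2 b a c" "area2 a b c = area2 a c b" for a b c
      by (fact area2_swap12, fact area2_swap23)
    show "4 * real (card S) ^ 3
        \<le> 5 * real (card {(a, b, c). a \<in> S \<and> b \<in> S \<and> c \<in> S \<and> 0 < area2 a b c})"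
      using cardN unfolding N_def .
  qed (rule exI, intro conjI allI ballI)
  then obtain t where t: "\<And>p. 0 < t p"
    and pos: "0 < (\<Sum>a\<in>S. \<Sum>b\<in>S. \<Sum>c\<in>S. t a * t b * t c * area2 a b c)" and bal: "\<And>p. p \<in> S \<Longrightarrow>
      3 * real (card S) * (\<Sum>b\<in>S. \<Sum>c\<in>S. t p * t b * t c * area2 p b c)
       \<le> 8 * (\<Sum>a\<in>S. \<Sum>b\<in>S. \<Sum>c\<in>S. t a * t b * t c * area2 a b c)"
    by blast
  obtain f g h where "orthonormal S t f g h"
    using orthonormal_exists [of S t a b c] fin t ab c by metis
  then interpret affine_kernel S t f g h by unfold_locales
  define \<tau> where "\<tau> p = t p * qre (K p p)" for p
  define C where "C p q = t p * t q * qnorm2 (K p q)" for p q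
  have diag_nonneg: "0 \<le> qre (K p p)" for p
    by (simp add: kernel_diag)
  have qnorm2_diag: "qnorm2 (K p p) = (qre (K p p))\<^sup>2" for p
    by (simp add: kernel_diag of_real_def)
  have "\<exists>p\<in>S. real 24 < real (card S) * \<tau> p"
  proof (rule rank_3_kernel_diag_large)
    show "0 \<le> \<tau> p" for p using t diag_nonneg by (simp add: \<tau>_def less_imp_le)
    show "(\<Sum>p\<in>S. \<tau> p) = 3" using sum_trace_kernel by (simp add: \<tau>_def)
    have "(\<Sum>q\<in>S. C p q) = \<tau> p" for p
      by (simp add: C_def \<tau>_def mult.assoc flip: sum_distrib_left sum_qnorm2_kernel)
    then show "(\<Sum>p\<in>S. \<Sum>q\<in>S. C p q) = 3" using \<open>sum \<tau> S = 3\<close> by simp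
    show "C p p = (\<tau> p)\<^sup>2" for p
      by (simp add: C_def \<tau>_def qnorm2_diag power_mult_distrib power2_eq_square)
    show "(\<Sum>p\<in>P. \<tau> p)\<^sup>2 \<le> 2 * (\<Sum>p\<in>P. \<Sum>q\<in>P. C p q)" if P: "P \<in> \<L>" for P
    proof -
      obtain L where L: "is_line L" "P = S \<inter> L" using P by (auto simp: \<L>_def)
      have "2 \<le> card P" using card_line [OF P] by simp
      then obtain Q where "Q \<subseteq> P" "card Q = 2" by (rule obtain_subset_with_card_n)
      then obtain p q where pq: "p \<in> P" "q \<in> P" "p \<noteq> q"
        unfolding card_2_iff by blast
      have Lpq: "L = line_thru p q" using is_line_eq_line_thru [OF L(1)] L(2) pq by auto
      obtain r where "r \<in> S" "noncollinear p q r"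
        using off [OF L(1)] Lpq pq by (auto simp: noncollinear_def)
      \<comment> \<open>A basis adapted to this line gives the rank 2 bound, which
        \<open>kernel_unique\<close> transfers to the fixed kernel \<open>K\<close>.\<close>
      then obtain f' g' h' where on': "orthonormal S t f' g' h'"
        and h': "\<And>x. x \<in> line_thru p q \<Longrightarrow> h' x = 0"
        using orthonormal_exists [of S t p q r] fin t pq L(2) by auto
      interpret k: affine_kernel S t f' g' h' using on' by unfold_locales
      have "kernel f' g' h' = K" by (rule kernel_unique) unfold_locales
      then show ?thesis
        using k.trace_line_le [of P] h' L(2) Lpq unfolding \<tau>_def C_def by auto
    qed
  qed
  then obtain p where p: "p \<in> S" and large_p: "24 < real (card S) * \<tau> p" by auto
  \<comment> \<open>The column of \<open>K\<close> at \<open>p\<close> has squared norm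
    \<open>qre (K p p)\<close> and value \<open>K p p\<close> at \<open>p\<close>, so the general
    bound becomes one on \<open>\<tau> p\<close>.\<close>
  have 1: "real (card S) * (t p * qnorm2 (K p p)) \<le> 24 * (\<Sum>q\<in>S. t q * qnorm2 (K q p))"
    by (rule affs_le_of_area2_balanced [where f = "\<lambda>q. K q p"])
      (fact kernel_affs, fact t, fact bal [OF p], fact pos, simp)
  have "qnorm2 (K q p) = qnorm2 (K p q)" for q
    by (metis qcnj_kernel qnorm2_simps(1))
  then have 2: "(\<Sum>q\<in>S. t q * qnorm2 (K q p)) = qre (K p p)"
    using sum_qnorm2_kernel [of p] by simp
  have "(real (card S) * \<tau> p) * qre (K p p) \<le> 24 * qre (K p p)"
    using 1 unfolding 2 qnorm2_diag by (simp add: \<tau>_def power2_eq_square ac_simps)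
  \<comment> \<open>Needed to cancel one factor; a vanishing diagonal entry would make
    \<open>\<tau> p\<close> zero.\<close>
  moreover have "0 < qre (K p p)"
    using large_p diag_nonneg [of p] by (cases "qre (K p p) = 0") (auto simp: \<tau>_def)
  ultimately show False using large_p by simp
qed

end
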